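(* Let $\mathcal Q=\mathcal U\cap\mathcal D\cap\mathcal G'$, where $\mathcal U$ is the set of (connected) cardinally unbounded two-step rules, $\mathcal D$ the set of diagonally unbounded two-step rules, and $\mathcal G'$ the complement of the set $\mathcal G$ of glued two-step rules. Let $\mathcal A$ be the set of aperiodic two-step rules. Then $$|\mathcal Q|=13749\qquad\text{and}\qquad|\mathcal Q\cap\mathcal A|=13745.$$ Counted up to the symmetry of the quarter plane, $$N_{G_2'}(\mathcal Q)=6912\qquad\text{and}\qquad N_{G_2'}(\mathcal Q\cap\mathcal A)=6909,$$ where $G_2'$ is the group comprising the identity and the element $\sigma'$ which swaps east and north steps and swaps south and west steps.
   Context: The four step types on $\mathbb Z^2$ are east $(1,0)$, north $(0,1)$, west $(-1,0)$ and south $(0,-1)$, abbreviated $e,n,w,s$. A two-step rule is a map $R:\{e,n,w,s\}^2\to\{0,1\}$, where $R(i,j)=1$ means that a step of type $i$ may be immediately followed by a step of type $j$. Its transfer matrix $T$ is the $4\times4$ matrix with $T_{ij}=R(i,j)$, rows and columns ordered $e,n,w,s$. The rule is connected if for all $i,j$ there is $k\ge1$ with $(T^k)_{ij}>0$; it is aperiodic if there is a single $k\ge1$ with $(T^k)_{ij}>0$ for all $i,j$. Let $I_\theta$ be the $4\times4$ identity matrix with its $\theta$-th diagonal entry replaced by $0$. A rule is: - north-bound if there is always a north step between two south steps (no $k\ge1$ has $((I_nTI_n)^k)_{ss}>0$); south-bound if there is always a south step between two north steps (no $k\ge1$ has $((I_sTI_s)^k)_{nn}>0$); vertically unbounded if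 neither; - east-bound if there is always an east step between two west steps (no $k\ge1$ has $((I_eTI_e)^k)_{ww}>0$); west-bound if there is always a west step between two east steps (no $k\ge1$ has $((I_wTI_w)^k)_{ee}>0$); horizontally unbounded if neither; - cardinally unbounded if it is both vertically and horizontally unbounded. $\mathcal U$ is the set of connected rules with this property. A rule is south-east-bound if all of $T_{nn},\ T_{ww},\ T_{nw}T_{wn},\ T_{ne}T_{ew}T_{wn},\ T_{nw}T_{we}T_{en},\ T_{wn}T_{ns}T_{sw},\ T_{ws}T_{sn}T_{nw}$ are zero; north-west-bound if all of $T_{ee},\ T_{ss},\ T_{es}T_{se},\ T_{en}T_{ns}T_{se},\ T_{es}T_{sn}T_{ne},\ T_{se}T_{ew}T_{ws},\ T_{sw}T_{we}T_{es}$ are zero; south-west-bound if all of $T_{ee},\ T_{nn},\ T_{ne}T_{en},\ T_{en}T_{ns}T_{se},\ T_{es}T_{sn}T_{ne},\ T_{ne}T_{ew}T_{wn},\ T_{nw}T_{we}T_{en}$ are zero. A rule is diagonally unbounded if it is none of south-east-bound, north-west-bound, south-west-bound. A rule is glued if all of $T_{en},\ T_{ee}T_{ew}T_{wn},\ T_{ne},\ T_{nn}T_{ns}T_{se}$ are zero. A permutation $\pi$ of $\{e,n,w,s\}$ acts on rules by $(\pi\cdot R)(\pi(i),\pi(j))=R(i,j)$. For a group $G$ acting on a set $X$ of rules, $N_G(X)$ denotes the number of orbits. *)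

theory Defs
  imports "HOL-Analysis.Finite_Cartesian_Product" "HOL-Algebra.Group_Action"
begin

datatype step = East | North | West | South

lemma UNIV_step: "(UNIV :: step set) = {East, North, West, South}"
  using step.exhaust by auto

instance step :: finite
  by standard (simp add: UNIV_step)

text \<open>The truth values stand for the values 0 and 1 of a rule.\<close>

type_synonym rule = "step \<Rightarrow> step \<Rightarrow> bool"

type_synonym step_matrix = "nat ^ step ^ step"

definition transfer :: "rule \<Rightarrow> step_matrix" where
  "transfer R = (\<chi> i j. of_bool (R i j))"

text \<open>The operator \<open>^\<close> on \<open>vec\<close> is componentwise, so powers for the matrix product
  are iterated explicitly.\<close>

definition matpow :: "step_matrix \<Rightarrow> nat \<Rightarrow> step_matrix" where
  "matpow A k = ((**) A ^^ k) (mat 1)"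

definition connected_rules :: "rule set" where
  "connected_rules = {R. \<forall>i j. \<exists>k\<ge>1. matpow (transfer R) k $ i $ j > 0}"

definition aperiodic_rules :: "rule set" where
  "aperiodic_rules = {R. \<exists>k\<ge>1. \<forall>i j. matpow (transfer R) k $ i $ j > 0}"

definition punctured_id :: "step \<Rightarrow> step_matrix" where
  "punctured_id \<theta> = (\<chi> i j. if i = j \<and> i \<noteq> \<theta> then 1 else 0)"

text \<open>There is always a \<open>\<theta>\<close> step between two \<open>i\<close> steps.\<close>

definition always_between :: "rule \<Rightarrow> step \<Rightarrow> step \<Rightarrow> bool" where
  "always_between R \<theta> i \<longleftrightarrow>
     \<not> (\<exists>k\<ge>1. matpow (punctured_id \<theta> ** transfer R ** punctured_id \<theta>) k $ i $ i > 0)"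

definition north_bound :: "rule \<Rightarrow> bool" where
  "north_bound R \<longleftrightarrow> always_between R North South"

definition south_bound :: "rule \<Rightarrow> bool" where
  "south_bound R \<longleftrightarrow> always_between R South North"

definition east_bound :: "rule \<Rightarrow> bool" where
  "east_bound R \<longleftrightarrow> always_between R East West"

definition west_bound :: "rule \<Rightarrow> bool" where
  "west_bound R \<longleftrightarrow> always_between R West East"

definition vertically_unbounded :: "rule \<Rightarrow> bool" where
  "vertically_unbounded R \<longleftrightarrow> \<not> north_bound R \<and> \<not> south_bound R"

definition horizontally_unbounded :: "rule \<Rightarrow> bool" where
  "horizontally_unbounded R \<longleftrightarrow> \<not> east_bound R \<and> \<not> west_bound R"

definition cardinally_unbounded :: "rule \<Rightarrow> bool" where
  "cardinally_unbounded R \<longleftrightarrow> vertically_unbounded R \<and> horizontally_unbounded R"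

definition cardinally_unbounded_rules :: "rule set" where
  "cardinally_unbounded_rules = {R \<in> connected_rules. cardinally_unbounded R}"

definition south_east_bound :: "rule \<Rightarrow> bool" where
  "south_east_bound R \<longleftrightarrow> (let T = transfer R in
     T$North$North = 0 \<and>
     T$West$West = 0 \<and>
     T$North$West * T$West$North = 0 \<and>
     T$North$East * T$East$West * T$West$North = 0 \<and>
     T$North$West * T$West$East * T$East$North = 0 \<and>
     T$West$North * T$North$South * T$South$West = 0 \<and>
     T$West$South * T$South$North * T$North$West = 0)"

definition north_west_bound :: "rule \<Rightarrow> bool" where
  "north_west_bound R \<longleftrightarrow> (let T = transfer R in
     T$East$East = 0 \<and>
     T$South$South = 0 \<and>
     T$East$South * T$South$East = 0 \<and>
     T$East$North * T$North$South * T$South$East = 0 \<and>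
     T$East$South * T$South$North * T$North$East = 0 \<and>
     T$South$East * T$East$West * T$West$South = 0 \<and>
     T$South$West * T$West$East * T$East$South = 0)"

definition south_west_bound :: "rule \<Rightarrow> bool" where
  "south_west_bound R \<longleftrightarrow> (let T = transfer R in
     T$East$East = 0 \<and>
     T$North$North = 0 \<and>
     T$North$East * T$East$North = 0 \<and>
     T$East$North * T$North$South * T$South$East = 0 \<and>
     T$East$South * T$South$North * T$North$East = 0 \<and>
     T$North$East * T$East$West * T$West$North = 0 \<and>
     T$North$West * T$West$East * T$East$North = 0)"

definition diagonally_unbounded_rules :: "rule set" where
  "diagonally_unbounded_rules =
     {R. \<not> south_east_bound R \<and> \<not> north_west_bound R \<and> \<not> south_west_bound R}"

definition glued_rules :: "rule set" where
  "glued_rules = {R. let T = transfer R in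
     T$East$North = 0 \<and>
     T$East$East * T$East$West * T$West$North = 0 \<and>
     T$North$East = 0 \<and>
     T$North$North * T$North$South * T$South$East = 0}"

definition quarter_plane_rules :: "rule set" where
  "quarter_plane_rules =
     cardinally_unbounded_rules \<inter> diagonally_unbounded_rules \<inter> - glued_rules"

definition rule_act :: "(step \<Rightarrow> step) \<Rightarrow> rule \<Rightarrow> rule" where
  "rule_act \<pi> R = (\<lambda>i j. R (inv_into UNIV \<pi> i) (inv_into UNIV \<pi> j))"

lemma rule_act_apply: "bij \<pi> \<Longrightarrow> rule_act \<pi> R (\<pi> i) (\<pi> j) = R i j"
  by (simp add: rule_act_def bij_is_inj)

primrec diagonal_swap :: "step \<Rightarrow> step" where
  "diagonal_swap East = North"
| "diagonal_swap North = East"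
| "diagonal_swap West = South"
| "diagonal_swap South = West"

definition diagonal_group :: "(step \<Rightarrow> step) monoid" where
  "diagonal_group = (BijGroup UNIV) \<lparr>carrier := {id, diagonal_swap}\<rparr>"

definition num_orbits :: "(step \<Rightarrow> step) monoid \<Rightarrow> rule set \<Rightarrow> nat" where
  "num_orbits G X = card (orbits G X rule_act)"

lemma diagonal_swap_involution [simp]: "diagonal_swap (diagonal_swap i) = i"
  by (cases i) auto

lemma bij_diagonal_swap: "bij diagonal_swap"
  by (rule o_bij[of diagonal_swap]) auto

lemma Bij_UNIV_iff: "f \<in> Bij UNIV \<longleftrightarrow> bij f"
  by (simp add: Bij_def)

lemma diagonal_group_subgroup: "subgroup {id, diagonal_swap} (BijGroup UNIV)"
proof -
  interpret B: group "BijGroup (UNIV :: step set)"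
    by (rule group_BijGroup)
  have mult: "f \<otimes>\<^bsub>BijGroup UNIV\<^esub> g = f \<circ> g" if "bij f" "bij g" for f g :: "step \<Rightarrow> step"
    using that by (auto simp: BijGroup_def Bij_UNIV_iff compose_def)
  have one: "\<one>\<^bsub>BijGroup UNIV\<^esub> = (id :: step \<Rightarrow> step)"
    by (auto simp: BijGroup_def)
  have car: "carrier (BijGroup UNIV) = {f :: step \<Rightarrow> step. bij f}"
    by (auto simp: BijGroup_def Bij_UNIV_iff)
  have sq: "diagonal_swap \<circ> diagonal_swap = id"
    by auto
  have inv_swap: "m_inv (BijGroup UNIV) diagonal_swap = diagonal_swap"
    by (rule B.inv_equality) (simp_all add: mult one car sq bij_diagonal_swap)
  have inv_id: "m_inv (BijGroup UNIV) id = (id :: step \<Rightarrow> step)"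
    using B.inv_one by (simp add: one)
  show ?thesis
    by (rule B.subgroupI) (auto simp: car mult bij_diagonal_swap sq inv_swap inv_id)
qed

lemma group_diagonal_group: "group diagonal_group"
  unfolding diagonal_group_def
  by (rule group.subgroup_imp_group[OF group_BijGroup diagonal_group_subgroup])

lemma compose_UNIV: "compose UNIV f g = f \<circ> g"
  by (auto simp: compose_def)

lemma group_action_rule_act: "group_action (BijGroup UNIV) UNIV rule_act"
proof -
  have comp: "rule_act (f \<circ> g) R = rule_act f (rule_act g R)" if "bij f" "bij g" for f g R
    using that by (simp add: rule_act_def o_inv_distrib)
  have id: "rule_act id R = R" for R
    by (simp add: rule_act_def)
  have bij: "bij (rule_act f)" if "bij f" for f
  proof (rule o_bij)
    have "rule_act (inv_into UNIV f) (rule_act f R) = R" for R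
      using that by (simp add: comp[symmetric] bij_imp_bij_inv bij_is_inj id)
    then show "rule_act (inv_into UNIV f) \<circ> rule_act f = id"
      by auto
    have "f \<circ> inv_into UNIV f = id"
      using that by (simp add: bij_is_surj flip: surj_iff)
    then have "rule_act f (rule_act (inv_into UNIV f) R) = R" for R
      using that by (simp add: comp[symmetric] bij_imp_bij_inv id)
    then show "rule_act f \<circ> rule_act (inv_into UNIV f) = id"
      by auto
  qed
  have "rule_act \<in> hom (BijGroup UNIV) (BijGroup UNIV)"
    by (auto simp: hom_def BijGroup_def Bij_UNIV_iff compose_UNIV bij comp)
  then show ?thesis
    by (intro group_action.intro group_hom.intro group_hom_axioms.intro group_BijGroup)
qed

lemma inv_diagonal_swap: "inv_into UNIV diagonal_swap = diagonal_swap"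
  by (rule inv_unique_comp) auto

lemma transfer_diagonal_swap:
  "transfer (rule_act diagonal_swap R) $ i $ j
     = transfer R $ diagonal_swap i $ diagonal_swap j"
  by (simp add: transfer_def rule_act_def inv_diagonal_swap)

lemma matrix_mult_diagonal_swap:
  fixes A A' B B' :: step_matrix
  assumes "\<And>i j. A' $ i $ j = A $ diagonal_swap i $ diagonal_swap j"
    and "\<And>i j. B' $ i $ j = B $ diagonal_swap i $ diagonal_swap j"
  shows "(A' ** B') $ i $ j = (A ** B) $ diagonal_swap i $ diagonal_swap j"
  by (simp add: matrix_matrix_mult_def assms
        sum.reindex_bij_betw[OF bij_diagonal_swap,
          of "\<lambda>k. A $ diagonal_swap i $ k * B $ k $ diagonal_swap j"])

lemma matpow_diagonal_swap:
  fixes A A' :: step_matrix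
  assumes "\<And>i j. A' $ i $ j = A $ diagonal_swap i $ diagonal_swap j"
  shows "matpow A' k $ i $ j = matpow A k $ diagonal_swap i $ diagonal_swap j"
proof (induction k arbitrary: i j)
  case 0
  then show ?case
    using bij_diagonal_swap by (auto simp: matpow_def mat_def bij_def inj_def)
next
  case (Suc k)
  have "(A' ** matpow A' k) $ i $ j = (A ** matpow A k) $ diagonal_swap i $ diagonal_swap j"
    by (rule matrix_mult_diagonal_swap) (simp_all add: assms Suc.IH)
  then show ?case
    by (simp add: matpow_def)
qed

lemma all_diagonal_swap: "(\<forall>i j. P (diagonal_swap i) (diagonal_swap j)) \<longleftrightarrow> (\<forall>i j. P i j)"
  by (metis diagonal_swap_involution)

lemma aperiodic_diagonal_swap:
  "rule_act diagonal_swap R \<in> aperiodic_rules \<longleftrightarrow> R \<in> aperiodic_rules"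
  using all_diagonal_swap[of "\<lambda>i j. matpow (transfer R) _ $ i $ j > 0"]
  by (simp add: aperiodic_rules_def matpow_diagonal_swap[OF transfer_diagonal_swap])

lemma connected_diagonal_swap:
  "rule_act diagonal_swap R \<in> connected_rules \<longleftrightarrow> R \<in> connected_rules"
  using all_diagonal_swap[of "\<lambda>i j. \<exists>k\<ge>1. matpow (transfer R) k $ i $ j > 0"]
  by (simp add: connected_rules_def matpow_diagonal_swap[OF transfer_diagonal_swap])

lemma always_between_diagonal_swap:
  "always_between (rule_act diagonal_swap R) \<theta> i
     \<longleftrightarrow> always_between R (diagonal_swap \<theta>) (diagonal_swap i)"
proof -
  have eq: "diagonal_swap a = diagonal_swap b \<longleftrightarrow> a = b" for a b
    by (metis diagonal_swap_involution)
  have P: "punctured_id \<theta> $ a $ b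
      = punctured_id (diagonal_swap \<theta>) $ diagonal_swap a $ diagonal_swap b" for a b
    by (simp add: punctured_id_def eq)
  have "matpow (punctured_id \<theta> ** transfer (rule_act diagonal_swap R) ** punctured_id \<theta>) k $ i $ i
      = matpow (punctured_id (diagonal_swap \<theta>) ** transfer R ** punctured_id (diagonal_swap \<theta>)) k
          $ diagonal_swap i $ diagonal_swap i" for k
    by (intro matpow_diagonal_swap matrix_mult_diagonal_swap P transfer_diagonal_swap)
  then show ?thesis
    by (simp add: always_between_def)
qed

lemma quarter_plane_diagonal_swap:
  "rule_act diagonal_swap R \<in> quarter_plane_rules \<longleftrightarrow> R \<in> quarter_plane_rules"
proof -
  have "cardinally_unbounded (rule_act diagonal_swap R) \<longleftrightarrow> cardinally_unbounded R"
    by (auto simp: cardinally_unbounded_def vertically_unbounded_def horizontally_unbounded_def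
        north_bound_def south_bound_def east_bound_def west_bound_def always_between_diagonal_swap)
  moreover have "south_east_bound (rule_act diagonal_swap R) \<longleftrightarrow> north_west_bound R"
    "north_west_bound (rule_act diagonal_swap R) \<longleftrightarrow> south_east_bound R"
    "south_west_bound (rule_act diagonal_swap R) \<longleftrightarrow> south_west_bound R"
    "rule_act diagonal_swap R \<in> glued_rules \<longleftrightarrow> R \<in> glued_rules"
    by (auto simp: south_east_bound_def north_west_bound_def south_west_bound_def glued_rules_def
        Let_def transfer_diagonal_swap)
  ultimately show ?thesis
    by (auto simp: quarter_plane_rules_def cardinally_unbounded_rules_def
        diagonally_unbounded_rules_def connected_diagonal_swap)
qed

end

theory Submission
  imports Defs
begin

text \<open>
  All the properties that make up the set of quarter-plane rules are monotone in the set of allowed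
  step pairs: allowing more pairs never destroys connectedness or unboundedness and never creates
  gluing. The set therefore consists of the models of a conjunction of disjunctions of conjunctions
  of positive atoms, one atom for each of the 16 step pairs. Two facts make this condition small.
  A digraph on two or more vertices is strongly connected exactly if an edge leaves every proper
  nonempty vertex set
  (\<open>strongly_connected_iff_cuts\<close>), which gives 14 clauses. A closed walk on three vertices can be
  shortened to a loop, a 2-cycle or a 3-cycle (\<open>tranclp_loop_iff\<close>), so that each of the four cardinal
  conditions is a single clause, just as the diagonal conditions and the gluing condition are. The
  number of models, 13749, is computed by branching over the atoms and simplifying after each
  decision (\<open>count_models_correct\<close>); most branches close early.

  A connected rule with a closed walk of length 2 and a closed walk of length 3 is aperiodic, since
  \<open>2\<close> and \<open>3\<close> are coprime (\<open>uniform_walk_length\<close>). In a quarter-plane rule without closed 2-walks all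
  four triples of steps would have to carry a directed triangle, which is impossible. Without closed
  3-walks the three diagonal conditions force all six 2-cycle edges between consecutive steps of the
  path south, east, north, west, and the absence of triangles forbids all edges inside
  \<open>{East, West}\<close> and \<open>{North, South}\<close>. Only the edges between west and south remain free. This
  leaves four rules, which are bipartite and hence not aperiodic (\<open>quarter_plane_not_aperiodic\<close>).

  The group has order 2, so twice the number of orbits is the number of rules plus the number of
  rules fixed by the swap (\<open>num_orbits_diagonal_group\<close>). A fixed rule is determined by its values on 8
  representative pairs, and the same counting procedure on these 8 atoms yields 75 fixed rules; 2 of
  them are among the four exceptional ones. Hence the orbit numbers are \<open>(13749 + 75) / 2\<close> and
  \<open>(13745 + 73) / 2\<close>.
\<close>

section \<open>Counting the models of a monotone condition\<close>

text \<open>A condition is a conjunction of disjunctions of conjunctions of positive atoms, given as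
  nested lists; a set of atoms satisfies it if for each clause it contains all the atoms of one of
  the terms. Allowing conjunctions inside the clauses keeps it much shorter than a conjunctive
  normal form.\<close>

definition satisfies :: "'a set \<Rightarrow> 'a list list list \<Rightarrow> bool" where
  "satisfies A F \<longleftrightarrow> (\<forall>c\<in>set F. \<exists>t\<in>set c. set t \<subseteq> A)"

text \<open>Deciding an atom positively shortens the terms in which it occurs, and a clause with an empty
  term is satisfied for good; deciding it negatively removes these terms.\<close>

definition put_in :: "'a \<Rightarrow> 'a list list list \<Rightarrow> 'a list list list" where
  "put_in x F = filter (\<lambda>c. [] \<notin> set c) (map (map (removeAll x)) F)"

definition leave_out :: "'a \<Rightarrow> 'a list list list \<Rightarrow> 'a list list list" where
  "leave_out x F = map (filter (\<lambda>t. x \<notin> set t)) F"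

text \<open>Recursion over the undecided atoms. It stops as soon as no clause is left, when all
  completions are models, or some clause has lost all its terms, when none is. With all atoms decided
  the remaining terms can only be satisfied by being empty.\<close>

fun count_models :: "'a list \<Rightarrow> 'a list list list \<Rightarrow> nat" where
  "count_models xs [] = 2 ^ length xs"
| "count_models [] (c # F) = of_bool (\<forall>d\<in>set (c # F). [] \<in> set d)"
| "count_models (x # xs) (c # F) =
     (if [] \<in> set (c # F) then 0
      else count_models xs (put_in x (c # F)) + count_models xs (leave_out x (c # F)))"

lemma satisfies_append: "satisfies A (F @ G) \<longleftrightarrow> satisfies A F \<and> satisfies A G"
  by (auto simp: satisfies_def)

lemma satisfies_Cons: "satisfies A (c # F) \<longleftrightarrow> (\<exists>t\<in>set c. set t \<subseteq> A) \<and> satisfies A F"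
  by (simp add: satisfies_def)

lemma satisfies_Nil [simp]: "satisfies A []"
  by (simp add: satisfies_def)

lemma satisfies_put_in: "satisfies A (put_in x F) \<longleftrightarrow> satisfies (insert x A) F"
proof -
  define d where "d c = map (removeAll x) c" for c :: "'a list list"
  have "set (removeAll x t) \<subseteq> A \<longleftrightarrow> set t \<subseteq> insert x A" for t
    by auto
  then have "(\<exists>t\<in>set c. set t \<subseteq> insert x A) \<longleftrightarrow> (\<exists>t\<in>set (d c). set t \<subseteq> A)" for c
    by (simp add: d_def)
  moreover have "\<exists>t\<in>set (d c). set t \<subseteq> A" if "[] \<in> set (d c)" for c
    using that by (intro bexI[of _ "[]"]) auto
  ultimately show ?thesis
    unfolding satisfies_def put_in_def d_def[symmetric] by auto
qed

lemma satisfies_leave_out: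
  assumes "x \<notin> A"
  shows "satisfies A (leave_out x F) \<longleftrightarrow> satisfies A F"
proof -
  have "(\<exists>t\<in>set (filter (\<lambda>t. x \<notin> set t) c). set t \<subseteq> A) \<longleftrightarrow> (\<exists>t\<in>set c. set t \<subseteq> A)" for c
    using assms by auto
  then show ?thesis
    by (simp add: satisfies_def leave_out_def)
qed

lemma card_subsets_insert:
  assumes "finite S" "x \<notin> S"
  shows "card {A. A \<subseteq> insert x S \<and> P A} =
    card {A. A \<subseteq> S \<and> P (insert x A)} + card {A. A \<subseteq> S \<and> P A}"
proof -
  have split: "{A. A \<subseteq> insert x S \<and> P A} =
      insert x ` {A. A \<subseteq> S \<and> P (insert x A)} \<union> {A. A \<subseteq> S \<and> P A}"
  proof (intro subset_antisym subsetI)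
    fix A assume A: "A \<in> {A. A \<subseteq> insert x S \<and> P A}"
    show "A \<in> insert x ` {A. A \<subseteq> S \<and> P (insert x A)} \<union> {A. A \<subseteq> S \<and> P A}"
    proof (cases "x \<in> A")
      case True
      then have "A = insert x (A - {x})" by auto
      then show ?thesis using A by (intro UnI1 image_eqI[of _ _ "A - {x}"]) auto
    qed (use A in auto)
  qed auto
  have "inj_on (insert x) {A. A \<subseteq> S \<and> P (insert x A)}"
    using assms(2) by (auto simp: inj_on_def insert_ident)
  moreover have "finite {A. A \<subseteq> S \<and> Q A}" for Q
    using assms(1) by simp
  ultimately show ?thesis
    unfolding split using assms(2)
    by (subst card_Un_disjoint) (auto simp: card_image)
qed

lemma count_models_correct:
  assumes "distinct xs"
  shows "count_models xs F = card {A. A \<subseteq> set xs \<and> satisfies A F}"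
  using assms
proof (induction xs F rule: count_models.induct)
  case (1 xs)
  have "{A. A \<subseteq> set xs \<and> satisfies A []} = Pow (set xs)"
    by (auto simp: satisfies_def)
  then show ?case
    using 1 by (simp add: card_Pow distinct_card)
next
  case (2 c F)
  have "{A. A \<subseteq> set [] \<and> satisfies A (c # F)} =
      (if \<forall>d\<in>set (c # F). [] \<in> set d then {{}} else {})"
    by (auto simp: satisfies_def)
  then show ?case
    by simp
next
  case (3 x xs c F)
  show ?case
  proof (cases "[] \<in> set (c # F)")
    case True
    then have "\<not> satisfies A (c # F)" for A
      by (force simp: satisfies_def)
    then show ?thesis
      using True by simp
  next
    case False
    have "x \<notin> set xs" "distinct xs"
      using "3.prems" by auto
    then have "{A. A \<subseteq> set xs \<and> satisfies A (leave_out x (c # F))} =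
        {A. A \<subseteq> set xs \<and> satisfies A (c # F)}"
      by (intro Collect_cong conj_cong refl satisfies_leave_out) auto
    then have "card {A. A \<subseteq> set (x # xs) \<and> satisfies A (c # F)} =
        count_models xs (put_in x (c # F)) + count_models xs (leave_out x (c # F))"
      unfolding list.set "3.IH"(1)[OF False \<open>distinct xs\<close>] "3.IH"(2)[OF False \<open>distinct xs\<close>]
        satisfies_put_in card_subsets_insert[OF finite_set \<open>x \<notin> set xs\<close>] by simp
    then show ?thesis
      using False by (simp only: count_models.simps if_False)
  qed
qed

section \<open>Positivity of matrix powers as reachability\<close>

text \<open>Positive matrix entries only record the existence of walks, so all the matrix conditions
  become statements about the transitive closure or the powers of the relation.\<close>

lemma matpow_pos_iff:
  "matpow A k $ i $ j > 0 \<longleftrightarrow> ((\<lambda>x y. A $ x $ y > 0) ^^ k) i j"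
proof (induction k arbitrary: i)
  case 0
  then show ?case by (simp add: matpow_def mat_def)
next
  case (Suc k)
  have "matpow A (Suc k) $ i $ j = (\<Sum>l\<in>UNIV. A $ i $ l * matpow A k $ l $ j)"
    by (simp add: matpow_def matrix_matrix_mult_def)
  then have "matpow A (Suc k) $ i $ j > 0 \<longleftrightarrow> (\<exists>l. A $ i $ l > 0 \<and> matpow A k $ l $ j > 0)"
    by (simp flip: neq0_conv)
  then show ?case
    unfolding Suc.IH relpowp.simps relpowp_commute[symmetric] by blast
qed

lemma ex_matpow_pos_iff:
  "(\<exists>k\<ge>1. matpow A k $ i $ j > 0) \<longleftrightarrow> (\<lambda>x y. A $ x $ y > 0)\<^sup>+\<^sup>+ i j"
  unfolding matpow_pos_iff tranclp_power One_nat_def Suc_le_eq ..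

lemma transfer_pos [simp]: "transfer R $ i $ j > 0 \<longleftrightarrow> R i j"
  by (simp add: transfer_def)

lemma transfer_eq_0 [simp]: "transfer R $ i $ j = 0 \<longleftrightarrow> \<not> R i j"
  by (simp add: transfer_def)

lemma connected_iff: "R \<in> connected_rules \<longleftrightarrow> (\<forall>i j. R\<^sup>+\<^sup>+ i j)"
  by (simp only: connected_rules_def mem_Collect_eq ex_matpow_pos_iff transfer_pos)

lemma aperiodic_iff: "R \<in> aperiodic_rules \<longleftrightarrow> (\<exists>k\<ge>1. \<forall>i j. (R ^^ k) i j)"
  by (simp only: aperiodic_rules_def mem_Collect_eq matpow_pos_iff transfer_pos)

lemma always_between_iff:
  "always_between R \<theta> i \<longleftrightarrow> \<not> (\<lambda>x y. x \<noteq> \<theta> \<and> R x y \<and> y \<noteq> \<theta>)\<^sup>+\<^sup>+ i i"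
proof -
  have left: "(punctured_id \<theta> ** M) $ x $ y = (if x = \<theta> then 0 else M $ x $ y)" for M x y
    by (cases "x = \<theta>") (simp_all add: matrix_matrix_mult_def punctured_id_def
        if_distrib[where f = "\<lambda>z. z * u" for u] cong: if_cong)
  have right: "(M ** punctured_id \<theta>) $ x $ y = (if y = \<theta> then 0 else M $ x $ y)" for M x y
    by (simp add: matrix_matrix_mult_def punctured_id_def
        if_distrib[where f = "\<lambda>z. u * z" for u] flip: if_if_eq_conj cong: if_cong)
  have "(punctured_id \<theta> ** transfer R ** punctured_id \<theta>) $ x $ y =
      of_bool (x \<noteq> \<theta> \<and> R x y \<and> y \<noteq> \<theta>)" for x y
    by (simp add: left right transfer_def)
  then show ?thesis
    by (simp only: always_between_def ex_matpow_pos_iff zero_less_of_bool_iff)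
qed

text \<open>If some vertex is not reachable from \<open>i\<close>, then the set of vertices reachable from \<open>i\<close> is a
  proper set that no edge leaves. Two distinct points are needed for \<open>i\<close> to reach itself by a
  nonempty walk: the walk goes through another point.\<close>

lemma strongly_connected_iff_cuts:
  fixes r :: "'a \<Rightarrow> 'a \<Rightarrow> bool" and a b :: 'a
  assumes "a \<noteq> b"
  shows "(\<forall>i j. r\<^sup>+\<^sup>+ i j) \<longleftrightarrow> (\<forall>S. S \<noteq> {} \<longrightarrow> S \<noteq> UNIV \<longrightarrow> (\<exists>i\<in>S. \<exists>j. j \<notin> S \<and> r i j))"
proof (intro iffI allI impI)
  fix S :: "'a set"
  assume reach: "\<forall>i j. r\<^sup>+\<^sup>+ i j" and "S \<noteq> {}" "S \<noteq> UNIV"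
  then obtain i j where ij: "i \<in> S" "j \<notin> S"
    by auto
  have "j \<in> S" if stay: "\<forall>x\<in>S. \<forall>y. r x y \<longrightarrow> y \<in> S"
    using reach[rule_format, of i j] ij(1) stay
    by (induction rule: tranclp_induct) auto
  then show "\<exists>i\<in>S. \<exists>j. j \<notin> S \<and> r i j"
    using ij by blast
next
  fix i j :: 'a
  assume cuts: "\<forall>S. S \<noteq> {} \<longrightarrow> S \<noteq> UNIV \<longrightarrow> (\<exists>i\<in>S. \<exists>j. j \<notin> S \<and> r i j)"
  have reach: "r\<^sup>*\<^sup>* i j" for i j
  proof -
    have "\<not> (\<exists>x\<in>{y. r\<^sup>*\<^sup>* i y}. \<exists>y. y \<notin> {y. r\<^sup>*\<^sup>* i y} \<and> r x y)"
      by (auto intro: rtranclp.rtrancl_into_rtrancl)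
    then have "{y. r\<^sup>*\<^sup>* i y} = UNIV"
      using cuts[rule_format, of "{y. r\<^sup>*\<^sup>* i y}"] by auto
    then show ?thesis by auto
  qed
  define m where "m = (if a = i then b else a)"
  have "m \<noteq> i"
    using assms by (auto simp: m_def)
  then have "r\<^sup>+\<^sup>+ i m"
    using reach[of i m] by (auto dest: rtranclpD)
  then show "r\<^sup>+\<^sup>+ i j"
    using reach[of m j] by (rule tranclp_rtranclp_tranclp)
qed

text \<open>A shortest closed walk through \<open>i\<close> visits the two other vertices at most once each, so it is one
  of the five cycles through \<open>i\<close>.\<close>

lemma tranclp_loop_iff:
  assumes support: "\<And>x y. r x y \<Longrightarrow> x \<in> {i, a, b} \<and> y \<in> {i, a, b}"
  shows "r\<^sup>+\<^sup>+ i i \<longleftrightarrow> r i i \<or> r i a \<and> r a i \<or> r i b \<and> r b i \<or>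
    r i a \<and> r a b \<and> r b i \<or> r i b \<and> r b a \<and> r a i" (is "_ \<longleftrightarrow> ?cycle")
proof
  \<comment> \<open>Without a short cycle through \<open>i\<close>, every vertex reachable from \<open>i\<close> is reached in at most two
    steps.\<close>
  have "(y = i \<longrightarrow> ?cycle) \<and> (y = a \<longrightarrow> ?cycle \<or> r i a \<or> r i b \<and> r b a) \<and>
      (y = b \<longrightarrow> ?cycle \<or> r i b \<or> r i a \<and> r a b)" if "r\<^sup>+\<^sup>+ i y" for y
    using that
  proof (induction rule: tranclp_induct)
    case (step y z)
    then have "y = i \<or> y = a \<or> y = b" "z = i \<or> z = a \<or> z = b"
      using support[of y z] by auto
    then show ?case
      using step by (elim disjE) auto
  qed auto
  then show "r\<^sup>+\<^sup>+ i i \<Longrightarrow> ?cycle"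
    by blast
next
  assume ?cycle
  then show "r\<^sup>+\<^sup>+ i i"
    by (elim disjE conjE) (blast intro: tranclp.intros)+
qed

section \<open>The quarter-plane rules as models of a monotone condition\<close>

definition edges :: "rule \<Rightarrow> (step \<times> step) set" where
  "edges R = {(i, j). R i j}"

lemma mem_edges_iff [simp]: "(i, j) \<in> edges R \<longleftrightarrow> R i j"
  by (simp add: edges_def)

lemma edges_curry [simp]: "edges (\<lambda>i j. (i, j) \<in> A) = A"
  by (simp add: edges_def)

abbreviation steps :: "step list" where
  "steps \<equiv> [East, North, West, South]"

text \<open>For each proper nonempty set of steps: some pair leads out of it.\<close>

definition cut_clauses :: "(step \<times> step) list list list" where
  "cut_clauses = map (\<lambda>S. [[(i, j)]. i \<leftarrow> S, j \<leftarrow> steps, j \<notin> set S])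
     (filter (\<lambda>S. S \<noteq> [] \<and> length S < 4) (subseqs steps))"

text \<open>There is a cycle through \<open>i\<close> that visits only \<open>i\<close>, \<open>a\<close> and \<open>b\<close>.\<close>

definition loop_clause :: "step \<Rightarrow> step \<Rightarrow> step \<Rightarrow> (step \<times> step) list list" where
  "loop_clause i a b = [[(i, i)], [(i, a), (a, i)], [(i, b), (b, i)],
     [(i, a), (a, b), (b, i)], [(i, b), (b, a), (a, i)]]"

text \<open>After the clauses for connectedness and for the four cardinal directions come the negations
  of south-east-bound, north-west-bound, south-west-bound and glued: each of these properties says
  that certain products vanish, so its negation says that all factors of some product are 1.\<close>

definition quarter_plane_clauses :: "(step \<times> step) list list list" where
  "quarter_plane_clauses = cut_clauses @
    [loop_clause South East West, loop_clause North East West,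
     loop_clause West North South, loop_clause East North South,
     [[(North, North)], [(West, West)], [(North, West), (West, North)],
      [(North, East), (East, West), (West, North)], [(North, West), (West, East), (East, North)],
      [(West, North), (North, South), (South, West)], [(West, South), (South, North), (North, West)]],
     [[(East, East)], [(South, South)], [(East, South), (South, East)],
      [(East, North), (North, South), (South, East)], [(East, South), (South, North), (North, East)],
      [(South, East), (East, West), (West, South)], [(South, West), (West, East), (East, South)]],
     [[(East, East)], [(North, North)], [(North, East), (East, North)],
      [(East, North), (North, South), (South, East)], [(East, South), (South, North), (North, East)],
      [(North, East), (East, West), (West, North)], [(North, West), (West, East), (East, North)]],
     [[(East, North)], [(East, East), (East, West), (West, North)], [(North, East)],
      [(North, North), (North, South), (South, East)]]]"

lemma connected_iff_cut_clauses: "R \<in> connected_rules \<longleftrightarrow> satisfies (edges R) cut_clauses"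
proof -
  have "set ` set (subseqs steps) = Pow UNIV"
    unfolding subseqs_powset by (simp add: UNIV_step insert_commute)
  then have "(\<forall>S::step set. P S) \<longleftrightarrow> (\<forall>S\<in>set (subseqs steps). P (set S))" for P
    by (metis Pow_UNIV UNIV_I ball_imageD image_iff)
  then have "R \<in> connected_rules \<longleftrightarrow> (\<forall>S\<in>set (subseqs steps).
      set S \<noteq> {} \<longrightarrow> set S \<noteq> UNIV \<longrightarrow> (\<exists>i\<in>set S. \<exists>j. j \<notin> set S \<and> R i j))"
    unfolding connected_iff strongly_connected_iff_cuts[OF step.distinct(1)] by simp
  also have "\<dots> \<longleftrightarrow> (\<forall>S\<in>set (subseqs steps).
      S \<noteq> [] \<longrightarrow> length S < 4 \<longrightarrow> (\<exists>i\<in>set S. \<exists>j\<in>UNIV. j \<notin> set S \<and> R i j))"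
  proof (intro ball_cong refl)
    fix S assume "S \<in> set (subseqs steps)"
    then have "set S = UNIV \<longleftrightarrow> \<not> length S < 4"
      by (auto simp: UNIV_step Let_def)
    then show "(set S \<noteq> {} \<longrightarrow> set S \<noteq> UNIV \<longrightarrow> (\<exists>i\<in>set S. \<exists>j. j \<notin> set S \<and> R i j)) \<longleftrightarrow>
        (S \<noteq> [] \<longrightarrow> length S < 4 \<longrightarrow> (\<exists>i\<in>set S. \<exists>j\<in>UNIV. j \<notin> set S \<and> R i j))"
      by simp
  qed
  also have "\<dots> \<longleftrightarrow> satisfies (edges R) cut_clauses"
    by (simp add: satisfies_def cut_clauses_def UNIV_step Let_def)
  finally show ?thesis .
qed

text \<open>Avoiding \<open>\<theta>\<close> leaves a digraph on three vertices, to which the list of short cycles applies.\<close>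

lemma unbounded_iff_loop_clause:
  assumes "UNIV = {\<theta>, i, a, b}" "distinct [\<theta>, i, a, b]"
  shows "\<not> always_between R \<theta> i \<longleftrightarrow> (\<exists>t\<in>set (loop_clause i a b). set t \<subseteq> edges R)"
proof -
  have "x \<in> {i, a, b}" if "x \<noteq> \<theta>" for x
    using assms(1) that by blast
  then have "(\<lambda>x y. x \<noteq> \<theta> \<and> R x y \<and> y \<noteq> \<theta>)\<^sup>+\<^sup>+ i i \<longleftrightarrow>
      R i i \<or> R i a \<and> R a i \<or> R i b \<and> R b i \<or>
      R i a \<and> R a b \<and> R b i \<or> R i b \<and> R b a \<and> R a i"
    using assms(2) by (subst tranclp_loop_iff[of _ i a b]) auto
  then show ?thesis
    by (auto simp: always_between_iff loop_clause_def)
qed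

lemma cardinally_unbounded_iff:
  "cardinally_unbounded R \<longleftrightarrow>
     (\<exists>t\<in>set (loop_clause South East West). set t \<subseteq> edges R) \<and>
     (\<exists>t\<in>set (loop_clause North East West). set t \<subseteq> edges R) \<and>
     (\<exists>t\<in>set (loop_clause West North South). set t \<subseteq> edges R) \<and>
     (\<exists>t\<in>set (loop_clause East North South). set t \<subseteq> edges R)"
  unfolding cardinally_unbounded_def vertically_unbounded_def horizontally_unbounded_def
    north_bound_def south_bound_def east_bound_def west_bound_def
  using unbounded_iff_loop_clause[of North South East West R]
    unbounded_iff_loop_clause[of South North East West R]
    unbounded_iff_loop_clause[of East West North South R]
    unbounded_iff_loop_clause[of West East North South R]
  by (simp add: UNIV_step insert_commute)

lemma quarter_plane_iff:
  "R \<in> quarter_plane_rules \<longleftrightarrow> satisfies (edges R) quarter_plane_clauses"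
  unfolding quarter_plane_rules_def cardinally_unbounded_rules_def diagonally_unbounded_rules_def
    glued_rules_def quarter_plane_clauses_def satisfies_append satisfies_Cons
    south_east_bound_def north_west_bound_def south_west_bound_def Let_def
  by (simp add: connected_iff_cut_clauses cardinally_unbounded_iff)

section \<open>The number of quarter-plane rules\<close>

text \<open>The order of the pairs is the branching order of the count. Connectedness concerns only pairs of
  distinct steps; with these decided first, branches that cannot become connected close early, and
  few terms are left when the diagonal pairs are reached.\<close>

definition step_pairs :: "(step \<times> step) list" where
  "step_pairs = [(i, j). i \<leftarrow> steps, j \<leftarrow> steps, i \<noteq> j] @ [(i, i). i \<leftarrow> steps]"

lemma set_step_pairs: "set step_pairs = UNIV"
proof -
  have "(i, j) \<in> set step_pairs" for i j
    by (cases i; cases j) (simp_all add: step_pairs_def)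
  then show ?thesis
    by auto
qed

lemma distinct_step_pairs: "distinct step_pairs"
  by (simp add: step_pairs_def)

text \<open>The branching takes place in the second simplification; the first one evaluates the lists of
  clauses and atoms.\<close>

lemma count_quarter_plane: "count_models step_pairs quarter_plane_clauses = 13749"
  by (simp add: step_pairs_def quarter_plane_clauses_def cut_clauses_def loop_clause_def Let_def
        del: count_models.simps,
      simp add: put_in_def leave_out_def)

lemma card_rules_satisfying:
  "card {R. satisfies (edges R) F} = card {A. satisfies A F}"
  by (rule bij_betw_same_card[of edges], rule bij_betw_byWitness[of _ "\<lambda>A i j. (i, j) \<in> A"]) auto

lemma card_quarter_plane: "card quarter_plane_rules = 13749"
proof -
  have eq: "quarter_plane_rules = {R. satisfies (edges R) quarter_plane_clauses}"
    by (auto simp: quarter_plane_iff)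
  have "card quarter_plane_rules = card {A. satisfies A quarter_plane_clauses}"
    unfolding eq by (rule card_rules_satisfying)
  also have "\<dots> = count_models step_pairs quarter_plane_clauses"
    by (simp add: count_models_correct set_step_pairs distinct_step_pairs)
  finally show ?thesis
    by (simp add: count_quarter_plane)
qed

section \<open>Aperiodic rules\<close>

lemma relpowp_repeat: "(r ^^ m) x x \<Longrightarrow> (r ^^ (n * m)) x x"
  by (induction n) (auto intro: relpowp_trans)

text \<open>Joining the two closed walks by a walk from \<open>a\<close> to \<open>b\<close> and back gives closed walks at \<open>a\<close> of
  lengths \<open>L\<close> and \<open>L + 3\<close>, one even and one odd. Padding with the closed walk of length 2 reaches every
  length from \<open>L + 2\<close> on, and then walks between any two vertices can be given the same length by a
  detour through \<open>a\<close>.\<close>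

lemma uniform_walk_length:
  fixes r :: "'a::finite \<Rightarrow> 'a \<Rightarrow> bool"
  assumes reach: "\<And>i j. r\<^sup>+\<^sup>+ i j" and two: "(r ^^ 2) a a" and three: "(r ^^ 3) b b"
  shows "\<exists>k\<ge>1. \<forall>i j. (r ^^ k) i j"
proof -
  have "\<exists>n. (r ^^ n) i j" for i j
    using reach[of i j] by (auto simp: tranclp_power)
  then obtain len where len: "\<And>i j. (r ^^ len i j) i j"
    by metis
  define L where "L = len a b + len b a"
  have loop: "(r ^^ m) a a" if m: "m \<ge> L + 2" for m
  proof (cases "even (m - L)")
    case True
    then obtain u where "m - L = u * 2"
      by (metis evenE mult.commute)
    then have "m = len a b + (len b a + u * 2)"
      using m by (simp add: L_def)
    then show ?thesis
      using relpowp_trans[OF len relpowp_trans[OF len relpowp_repeat[OF two, of u]]] by simp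
  next
    case False
    then have "even (m - L - 3)" "m - L \<ge> 3"
      using m by presburger+
    then obtain u where "m - L - 3 = u * 2"
      by (metis evenE mult.commute)
    then have "m = len a b + (3 + (len b a + u * 2))"
      using \<open>m - L \<ge> 3\<close> by (simp add: L_def)
    then show ?thesis
      using relpowp_trans[OF len relpowp_trans[OF three relpowp_trans[OF len relpowp_repeat[OF two, of u]]]]
      by simp
  qed
  \<comment> \<open>Only the bound on the combined length of a walk to \<open>a\<close> and a walk from \<open>a\<close> matters.\<close>
  define M where "M = (\<Sum>i\<in>UNIV. len i a) + (\<Sum>j\<in>UNIV. len a j)"
  have "(r ^^ (M + (L + 2))) i j" for i j
  proof -
    have "len i a \<le> (\<Sum>i\<in>UNIV. len i a)" "len a j \<le> (\<Sum>j\<in>UNIV. len a j)"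
      by (auto intro: member_le_sum)
    then have bound: "len i a + len a j \<le> M"
      by (simp add: M_def)
    have "(r ^^ (len i a + ((M - (len i a + len a j) + (L + 2)) + len a j))) i j"
      by (intro relpowp_trans[OF len] relpowp_trans[OF loop len]) simp
    also have "len i a + ((M - (len i a + len a j) + (L + 2)) + len a j) = M + (L + 2)"
      using bound by simp
    finally show ?thesis .
  qed
  then show ?thesis
    by (intro exI[of _ "M + (L + 2)"]) simp
qed

text \<open>All pairs between \<open>{East, West}\<close> and \<open>{North, South}\<close> are allowed, except that \<open>p\<close> and \<open>q\<close> decide
  about west-south and south-west.\<close>

definition bipartite_rule :: "bool \<Rightarrow> bool \<Rightarrow> rule" where
  "bipartite_rule p q i j \<longleftrightarrow> (i \<in> {East, West}) \<noteq> (j \<in> {East, West}) \<and>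
     (i = West \<and> j = South \<longrightarrow> p) \<and> (i = South \<and> j = West \<longrightarrow> q)"

text \<open>Each step changes sides, so the length of a walk is determined modulo 2 by its end points.\<close>

lemma bipartite_rule_not_aperiodic: "bipartite_rule p q \<notin> aperiodic_rules"
proof -
  define H where "H = {East, West}"
  have parity: "(bipartite_rule p q ^^ k) i j \<Longrightarrow> (i \<in> H \<longleftrightarrow> j \<in> H) \<longleftrightarrow> even k" for k i j
  proof (induction k arbitrary: j)
    case (Suc k)
    then obtain l where "(bipartite_rule p q ^^ k) i l" "bipartite_rule p q l j"
      by auto
    then have "(i \<in> H \<longleftrightarrow> l \<in> H) \<longleftrightarrow> even k" "(l \<in> H) \<noteq> (j \<in> H)"
      by (simp only: Suc.IH, simp add: bipartite_rule_def H_def)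
    then show ?case
      by auto
  qed simp
  have "\<not> (\<forall>i j. (bipartite_rule p q ^^ k) i j)" for k
    using parity[of k East East] parity[of k East North] by (auto simp: H_def)
  then show ?thesis
    unfolding aperiodic_iff by blast
qed

lemmas quarter_plane_clauses_unfold =
  quarter_plane_clauses_def cut_clauses_def loop_clause_def satisfies_append satisfies_Cons

lemma bipartite_rule_quarter_plane: "bipartite_rule p q \<in> quarter_plane_rules"
  unfolding quarter_plane_iff
  by (simp add: quarter_plane_clauses_unfold Let_def bipartite_rule_def)

lemma quarter_plane_unbounded:
  assumes "R \<in> quarter_plane_rules"
  shows "\<exists>t\<in>set (loop_clause South East West). set t \<subseteq> edges R"
    "\<exists>t\<in>set (loop_clause North East West). set t \<subseteq> edges R"
    "\<exists>t\<in>set (loop_clause West North South). set t \<subseteq> edges R"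
    "\<exists>t\<in>set (loop_clause East North South). set t \<subseteq> edges R"
    "\<not> south_east_bound R" "\<not> north_west_bound R" "\<not> south_west_bound R"
  using assms
  by (simp_all add: quarter_plane_rules_def cardinally_unbounded_rules_def
      diagonally_unbounded_rules_def cardinally_unbounded_iff)

text \<open>Without loops and 2-cycles, each cardinal condition gives a directed triangle on three of the
  four steps. Two triples of steps share a pair, so the orientation of one triangle determines that of
  the others, and the four orientations are incompatible.\<close>

lemma quarter_plane_closed_2_walk:
  assumes "R \<in> quarter_plane_rules"
  shows "\<exists>a. (R ^^ 2) a a"
proof (rule ccontr)
  assume none: "\<nexists>a. (R ^^ 2) a a"
  have no: "\<not> (R i j \<and> R j i)" for i j
    using none by (auto simp: numeral_2_eq_2)
  then have "\<not> R i i" for i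
    by blast
  with no show False
    using quarter_plane_unbounded(1-4)[OF assms] by (auto simp: loop_clause_def)
qed

text \<open>With loops and triangles excluded, each of the three diagonal conditions can only hold by its
  2-cycle. The six edges obtained in this way exclude the four remaining pairs of opposite steps, each
  of which would complete a triangle.\<close>

lemma quarter_plane_no_closed_3_walk:
  assumes R: "R \<in> quarter_plane_rules" and none: "\<nexists>b. (R ^^ 3) b b"
  shows "R = bipartite_rule (R West South) (R South West)"
proof -
  have no: "\<not> (R i j \<and> R j l \<and> R l i)" for i j l
    using none by (auto simp: numeral_3_eq_3)
  then have loop: "\<not> R i i" for i
    by blast
  have en: "R East North" "R North East" and nw: "R North West" "R West North"
    and es: "R East South" "R South East"
    using quarter_plane_unbounded(5-7)[OF R] no loop
    by (auto simp: south_east_bound_def north_west_bound_def south_west_bound_def Let_def)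
  then have "\<not> R East West" "\<not> R West East" "\<not> R North South" "\<not> R South North"
    using no by blast+
  with en nw es loop show ?thesis
    by (intro ext, rename_tac i j, case_tac i; case_tac j; simp add: bipartite_rule_def)
qed

lemma quarter_plane_not_aperiodic:
  "quarter_plane_rules - aperiodic_rules =
    {bipartite_rule True True, bipartite_rule True False,
     bipartite_rule False True, bipartite_rule False False}"
proof (intro subset_antisym subsetI)
  fix R assume R: "R \<in> quarter_plane_rules - aperiodic_rules"
  then have reach: "\<And>i j. R\<^sup>+\<^sup>+ i j"
    by (simp add: quarter_plane_rules_def cardinally_unbounded_rules_def connected_iff)
  obtain a where two: "(R ^^ 2) a a"
    using R quarter_plane_closed_2_walk[of R] by blast
  have "\<nexists>b. (R ^^ 3) b b"
  proof
    assume "\<exists>b. (R ^^ 3) b b"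
    then have "\<exists>k\<ge>1. \<forall>i j. (R ^^ k) i j"
      using uniform_walk_length[OF reach two] by blast
    then show False
      using R by (simp only: Diff_iff aperiodic_iff simp_thms)
  qed
  then have "R = bipartite_rule (R West South) (R South West)"
    using R by (intro quarter_plane_no_closed_3_walk) auto
  then show "R \<in> {bipartite_rule True True, bipartite_rule True False,
      bipartite_rule False True, bipartite_rule False False}"
    by (cases "R West South"; cases "R South West") simp_all
qed (auto simp: bipartite_rule_quarter_plane bipartite_rule_not_aperiodic)

lemma bipartite_rule_eq_iff: "bipartite_rule p q = bipartite_rule p' q' \<longleftrightarrow> p = p' \<and> q = q'"
proof
  assume eq: "bipartite_rule p q = bipartite_rule p' q'"
  show "p = p' \<and> q = q'"
    using fun_cong[OF fun_cong[OF eq, of West], of South]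
      fun_cong[OF fun_cong[OF eq, of South], of West]
    by (simp add: bipartite_rule_def)
qed simp

lemma card_not_aperiodic: "card (quarter_plane_rules - aperiodic_rules) = 4"
  by (simp add: quarter_plane_not_aperiodic bipartite_rule_eq_iff)

section \<open>Orbits of the diagonal reflection\<close>

text \<open>Counting each element with weight 1 and each fixed point once more gives every orbit the total
  weight 2.\<close>

lemma card_orbits_involution:
  assumes "finite X" and closed: "\<And>x. x \<in> X \<Longrightarrow> f x \<in> X" and inv: "\<And>x. f (f x) = x"
  shows "2 * card ((\<lambda>x. {x, f x}) ` X) = card X + card {x \<in> X. f x = x}"
proof -
  define weight where "weight x = (1 + of_bool (f x = x) :: nat)" for x
  have "card {x \<in> X. f x = x} = (\<Sum>x\<in>X. of_bool (f x = x))"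
    using assms(1) by (simp add: of_bool_def sum.If_cases Int_def)
  then have "card X + card {x \<in> X. f x = x} = (\<Sum>x\<in>X. weight x)"
    by (simp only: weight_def sum.distrib card_eq_sum)
  also have "\<dots> = (\<Sum>c\<in>(\<lambda>x. {x, f x}) ` X. \<Sum>x | x \<in> X \<and> {x, f x} = c. weight x)"
    using assms(1) by (rule sum.image_gen)
  also have "\<dots> = (\<Sum>c\<in>(\<lambda>x. {x, f x}) ` X. 2)"
  proof (rule sum.cong[OF refl])
    fix c assume "c \<in> (\<lambda>x. {x, f x}) ` X"
    then obtain y where y: "y \<in> X" "c = {y, f y}"
      by auto
    then have "{x \<in> X. {x, f x} = c} = {y, f y}"
      using closed inv by (auto simp: doubleton_eq_iff)
    then show "(\<Sum>x | x \<in> X \<and> {x, f x} = c. weight x) = 2"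
      by (cases "f y = y") (auto simp: weight_def inv)
  qed
  finally show ?thesis
    by simp
qed

lemma num_orbits_diagonal_group:
  assumes "\<And>R. R \<in> X \<Longrightarrow> rule_act diagonal_swap R \<in> X"
  shows "2 * num_orbits diagonal_group X =
    card X + card {R \<in> X. rule_act diagonal_swap R = R}"
proof -
  have "orbit diagonal_group rule_act R = {R, rule_act diagonal_swap R}" for R
  proof -
    have "rule_act id R = R"
      by (simp add: rule_act_def)
    then show ?thesis
      unfolding orbit_def Setcompr_eq_image by (simp add: diagonal_group_def)
  qed
  then have "orbits diagonal_group X rule_act = (\<lambda>R. {R, rule_act diagonal_swap R}) ` X"
    by (auto simp: orbits_def)
  moreover have "rule_act diagonal_swap (rule_act diagonal_swap R) = R" for R
    by (simp add: rule_act_def inv_diagonal_swap)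
  ultimately show ?thesis
    unfolding num_orbits_def using assms by (simp add: card_orbits_involution)
qed

text \<open>In each orbit of the swap on step pairs exactly one pair starts with east or west, because the
  swap exchanges \<open>{East, West}\<close> with \<open>{North, South}\<close>.\<close>

definition swap_rep :: "step \<times> step \<Rightarrow> step \<times> step" where
  "swap_rep p = (if fst p \<in> {East, West} then p else map_prod diagonal_swap diagonal_swap p)"

definition swap_reps :: "(step \<times> step) list" where
  "swap_reps = [(i, j). i \<leftarrow> [East, West], j \<leftarrow> steps]"

text \<open>Identifying atoms in a condition counts the models that are unions of the fibres of \<open>h\<close>.\<close>

lemma satisfies_vimage: "satisfies (h -` A) F \<longleftrightarrow> satisfies A (map (map (map h)) F)"
  by (simp add: satisfies_def image_subset_iff_subset_vimage)

lemma swap_rep_in_reps: "swap_rep p \<in> set swap_reps"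
  by (cases p; cases "fst p"; cases "snd p") (auto simp: swap_rep_def swap_reps_def)

lemma swap_rep_ident: "p \<in> set swap_reps \<Longrightarrow> swap_rep p = p"
  by (auto simp: swap_rep_def swap_reps_def)

lemma rule_act_fixed_iff: "rule_act diagonal_swap R = R \<longleftrightarrow> (\<forall>p. swap_rep p \<in> edges R \<longleftrightarrow> p \<in> edges R)"
proof -
  have "rule_act diagonal_swap R = R \<longleftrightarrow> (\<forall>i j. R (diagonal_swap i) (diagonal_swap j) = R i j)"
    by (auto simp: rule_act_def inv_diagonal_swap fun_eq_iff)
  also have "\<dots> \<longleftrightarrow> (\<forall>i j. i \<notin> {East, West} \<longrightarrow> R (diagonal_swap i) (diagonal_swap j) = R i j)"
    by (metis diagonal_swap.simps diagonal_swap_involution insertE singletonD step.distinct)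
  finally show ?thesis
    by (auto simp: swap_rep_def)
qed

lemma card_fixed_satisfying:
  "card {R. rule_act diagonal_swap R = R \<and> satisfies (edges R) F} =
    card {A. A \<subseteq> set swap_reps \<and> satisfies A (map (map (map swap_rep)) F)}"
proof (rule bij_betw_same_card, rule bij_betw_byWitness)
  let ?R = "\<lambda>A i j. swap_rep (i, j) \<in> A"
  have idem: "swap_rep (swap_rep p) = swap_rep p" for p
    by (simp add: swap_rep_in_reps swap_rep_ident)
  have edges: "edges (?R A) = swap_rep -` A" for A
    by auto
  show "\<forall>R\<in>{R. rule_act diagonal_swap R = R \<and> satisfies (edges R) F}.
      ?R (edges R \<inter> set swap_reps) = R"
    unfolding rule_act_fixed_iff by (auto simp: swap_rep_in_reps fun_eq_iff)
  show "\<forall>A\<in>{A. A \<subseteq> set swap_reps \<and> satisfies A (map (map (map swap_rep)) F)}.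
      edges (?R A) \<inter> set swap_reps = A"
    by (auto simp: swap_rep_ident)
  show "(\<lambda>R. edges R \<inter> set swap_reps) ` {R. rule_act diagonal_swap R = R \<and> satisfies (edges R) F}
      \<subseteq> {A. A \<subseteq> set swap_reps \<and> satisfies A (map (map (map swap_rep)) F)}"
  proof (intro image_subsetI CollectI conjI)
    fix R assume R: "R \<in> {R. rule_act diagonal_swap R = R \<and> satisfies (edges R) F}"
    then have "swap_rep -` (edges R \<inter> set swap_reps) = edges R"
      unfolding rule_act_fixed_iff by (simp add: set_eq_iff swap_rep_in_reps)
    then show "satisfies (edges R \<inter> set swap_reps) (map (map (map swap_rep)) F)"
      using R unfolding satisfies_vimage[symmetric] by simp
  qed simp
  show "?R ` {A. A \<subseteq> set swap_reps \<and> satisfies A (map (map (map swap_rep)) F)}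
      \<subseteq> {R. rule_act diagonal_swap R = R \<and> satisfies (edges R) F}"
    by (auto simp: rule_act_fixed_iff edges idem simp flip: satisfies_vimage)
qed

lemma count_fixed:
  "count_models swap_reps (map (map (map swap_rep)) quarter_plane_clauses) = 75"
  by (simp add: swap_reps_def swap_rep_def quarter_plane_clauses_def cut_clauses_def
        loop_clause_def Let_def del: count_models.simps,
      simp add: put_in_def leave_out_def)

lemma card_fixed_quarter_plane:
  "card {R \<in> quarter_plane_rules. rule_act diagonal_swap R = R} = 75"
proof -
  have eq: "{R \<in> quarter_plane_rules. rule_act diagonal_swap R = R} =
      {R. rule_act diagonal_swap R = R \<and> satisfies (edges R) quarter_plane_clauses}"
    by (auto simp: quarter_plane_iff)
  have "distinct swap_reps"
    by (simp add: swap_reps_def)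
  then show ?thesis
    unfolding eq card_fixed_satisfying
    by (simp only: count_fixed flip: count_models_correct)
qed

lemma card_fixed_not_aperiodic:
  "card {R \<in> quarter_plane_rules - aperiodic_rules. rule_act diagonal_swap R = R} = 2"
proof -
  have "rule_act diagonal_swap (bipartite_rule p q) = bipartite_rule q p" for p q
    unfolding fun_eq_iff
    by (intro allI, rename_tac i j, case_tac i; case_tac j;
      simp add: rule_act_def inv_diagonal_swap bipartite_rule_def)
  then have "{R \<in> quarter_plane_rules - aperiodic_rules. rule_act diagonal_swap R = R} =
      {bipartite_rule True True, bipartite_rule False False}"
    unfolding quarter_plane_not_aperiodic by (auto simp: bipartite_rule_eq_iff)
  then show ?thesis
    by (simp add: bipartite_rule_eq_iff)
qed

theorem lemma18:
  shows "card quarter_plane_rules = 13749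
    \<and> card (quarter_plane_rules \<inter> aperiodic_rules) = 13745
    \<and> num_orbits diagonal_group quarter_plane_rules = 6912
    \<and> num_orbits diagonal_group (quarter_plane_rules \<inter> aperiodic_rules) = 6909"
proof -
  have split: "card X = card (X \<inter> aperiodic_rules) + card (X - aperiodic_rules)" for X
    by (rule card_Int_Diff) simp
  have Q: "2 * num_orbits diagonal_group quarter_plane_rules = 13749 + 75"
    using num_orbits_diagonal_group[of quarter_plane_rules]
    by (simp add: quarter_plane_diagonal_swap card_quarter_plane card_fixed_quarter_plane)
  have A: "card (quarter_plane_rules \<inter> aperiodic_rules) = 13745"
    using split[of quarter_plane_rules] card_quarter_plane card_not_aperiodic by simp
  have "card {R \<in> quarter_plane_rules \<inter> aperiodic_rules. rule_act diagonal_swap R = R} = 73"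
  proof -
    have "{R \<in> quarter_plane_rules. rule_act diagonal_swap R = R} \<inter> aperiodic_rules =
        {R \<in> quarter_plane_rules \<inter> aperiodic_rules. rule_act diagonal_swap R = R}"
      "{R \<in> quarter_plane_rules. rule_act diagonal_swap R = R} - aperiodic_rules =
        {R \<in> quarter_plane_rules - aperiodic_rules. rule_act diagonal_swap R = R}"
      by auto
    then show ?thesis
      using split[of "{R \<in> quarter_plane_rules. rule_act diagonal_swap R = R}"]
        card_fixed_quarter_plane card_fixed_not_aperiodic by simp
  qed
  then have "2 * num_orbits diagonal_group (quarter_plane_rules \<inter> aperiodic_rules) = 13745 + 73"
    using num_orbits_diagonal_group[of "quarter_plane_rules \<inter> aperiodic_rules"] A
    by (simp add: quarter_plane_diagonal_swap aperiodic_diagonal_swap)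
  then show ?thesis
    using Q A card_quarter_plane by simp
qed

end
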